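(* Let $\partial\mathbf{Y}$ be the boundary of a random micro domain $\mathbf{Y}\subset\mathbb{R}^2$ generated by a $\Phi$-valued random element, and let $\langle\cdot,\cdot\rangle_{\partial\mathbf{Y}}$ and $\|\cdot\|_{\partial\mathbf{Y}}$ be the standard $L^2$-inner product and norm over $\partial\mathbf{Y}$. Let $\mathbf{r}_1,\mathbf{r}_2$ be the Riesz representors on $\partial\mathbf{Y}$, and let $\mathbf{s}_1=\mathcal{O}[\tilde{\mathbf{r}}_1,\partial\mathbf{Y}]$ and $\mathbf{s}_2=\mathcal{O}[\tilde{\mathbf{r}}_2,\partial\mathbf{Y}]$ be approximations of $\mathbf{r}_1$ and $\mathbf{r}_2$, respectively, all taking values in $C(\partial\mathbf{Y},\mathbb{R}^2)$. Let $h$ be the micro boundary data on $\partial\mathbf{Y}$. Assume that $\mathbf{r}_1$ and $h$ are almost surely uniformly $\eta_1$-aligned and that $\mathbf{s}_2$ and $h$ are almost surely uniformly $\eta_2$-aligned, with $0<\eta_1,\eta_2<1$. Assume that the slip amount $\langle\mathbf{r}_1,h\rangle_{\partial\mathbf{Y}}/\langle\mathbf{r}_2,h\rangle_{\partial\mathbf{Y}}$ is almost surely bounded (in absolute value) by $C$ for some $C>0$. Finally, assume that for some $\delta>0$ $$\mathbb{E}\left[\frac{\|\mathbf{s}_1-\mathbf{r}_1\|^2_{\partial\mathbf{Y}}}{\|\mathbf{r}_1\|^2_{\partial\mathbf{Y}}}\right]\le\delta^2\qquad\text{and}\qquad\mathbb{E}\left[\frac{\|\mathbf{s}_2-\mathbf{r}_2\|^2_{\partial\mathbf{Y}}}{\|\mathbf{s}_2\|^2_{\partial\mathbf{Y}}}\right]\le\delta^2.$$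 Then $$\mathbb{E}\left[\left|\frac{\langle\mathbf{r}_1,h\rangle_{\partial\mathbf{Y}}}{\langle\mathbf{r}_2,h\rangle_{\partial\mathbf{Y}}}-\frac{\langle\mathbf{s}_1,h\rangle_{\partial\mathbf{Y}}}{\langle\mathbf{s}_2,h\rangle_{\partial\mathbf{Y}}}\right|\right]\le C\left(\delta(\eta_1^{-1}+\eta_2^{-1})+\delta^2\eta_1^{-1}\eta_2^{-1}\right).$$
   Context: Bold symbols denote random variables. $\Phi$ is a set of injective curves $\phi\in C^2(\mathbb{T};\mathbb{R}^2)$, where $\mathbb{T}$ is the unit circle; each $\phi\in\Phi$ determines a micro domain $Y$ with boundary $\partial Y=\phi(\mathbb{T})$. Alignment: two elements $v,w$ of a Hilbert space are $\eta$-aligned, $0<\eta<1$, if $\langle v,w\rangle/(\|v\|\|w\|)\ge\eta$. Random elements $\mathbf{v},\mathbf{w}$ are almost surely uniformly $\eta$-aligned if the probability that they are not $\eta$-aligned is $0$. Here the Hilbert space is $L^2(\partial\mathbf{Y},\mathbb{R}^2)$. Riesz representors: let $Y$ be a micro domain containing a straight line segment $L$ with unit tangent $t$ and unit normal $n$. For boundary data $h\in C(\partial Y,\mathbb{R}^2)$ with zero net flow through $\partial Y$, let $\chi$ be the solution of the Stokes problem $-\Delta\chi+\nabla\pi=0$, $\nabla\cdot\chi=0$ in $Y$, $\chi=h$ on $\partial Y$. The Riesz representors $r_1,r_2\in C(\partial Y,\mathbb{R}^2)$ are fields, depending only on $Y$ and $L$, such that $\langle r_1,h\rangle_{\partial Y}=\langle\chi,t\rangle_L$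 and $\langle r_2,h\rangle_{\partial Y}=\langle\partial_n\chi,t\rangle_L$ for all such $h$, where $\langle\cdot,\cdot\rangle_L$ is the $L^2$-inner product on $L$. The operator $\mathcal{O}$ is an arbitrary (learned) map producing, from the domain and certain intermediate quantities $\tilde{\mathbf{r}}_1,\tilde{\mathbf{r}}_2$ determined by $\mathbf{Y}$ and $L$, fields $\mathbf{s}_1,\mathbf{s}_2$ on $\partial\mathbf{Y}$; no property of it is used other than those stated in the claim. All quantities are assumed measurable. *)

theory Defs
  imports "HOL-Probability.Probability"
begin

type_synonym plane = "real ^ 2"
type_synonym field = "plane \<Rightarrow> plane"

text \<open>A curve \<open>\<phi> : \<T> \<rightarrow> \<real>\<^sup>2\<close> is a function on \<^typ>\<open>complex\<close> of which only the values on
  the unit circle matter; \<open>lift \<phi>\<close> is its \<open>2\<pi>\<close>-periodic parametrisation.  Smoothness on the circle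
  is smoothness of this lift.\<close>

type_synonym curve = "complex \<Rightarrow> plane"

definition lift :: "curve \<Rightarrow> real \<Rightarrow> plane" where
  "lift \<phi> \<theta> = \<phi> (cis \<theta>)"

definition velocity :: "curve \<Rightarrow> real \<Rightarrow> plane" where
  "velocity \<phi> \<theta> = vector_derivative (lift \<phi>) (at \<theta>)"

definition C2_circle :: "curve \<Rightarrow> bool" where
  "C2_circle \<phi> \<longleftrightarrow> lift \<phi> C1_differentiable_on UNIV \<and> velocity \<phi> C1_differentiable_on UNIV"

definition micro_curve :: "curve \<Rightarrow> bool" where
  "micro_curve \<phi> \<longleftrightarrow> C2_circle \<phi> \<and> inj_on \<phi> (sphere 0 1)"

definition bd :: "curve \<Rightarrow> plane set" where
  "bd \<phi> = \<phi> ` sphere 0 1"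

text \<open>The micro domain is the bounded component of the complement of the Jordan curve.\<close>

definition micro_domain :: "curve \<Rightarrow> plane set" where
  "micro_domain \<phi> = inside (bd \<phi>)"


text \<open>The \<open>L\<^sup>2\<close> inner product over the boundary is taken with respect to arc length
  \<open>|\<gamma>'(\<theta>)| d\<theta>\<close>, where \<open>\<gamma> = lift \<phi>\<close>.\<close>

definition bd_inner :: "curve \<Rightarrow> field \<Rightarrow> field \<Rightarrow> real" where
  "bd_inner \<phi> f g =
     integral {0..2 * pi} (\<lambda>\<theta>. (f (lift \<phi> \<theta>) \<bullet> g (lift \<phi> \<theta>)) * norm (velocity \<phi> \<theta>))"

definition bd_norm :: "curve \<Rightarrow> field \<Rightarrow> real" where
  "bd_norm \<phi> f = sqrt (bd_inner \<phi> f f)"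

text \<open>The normal times the arc length element is \<open>\<plusminus>(\<gamma>'\<^sub>2, -\<gamma>'\<^sub>1) d\<theta>\<close>, the sign being given by the
  orientation of the curve and irrelevant for the vanishing of the flow.\<close>

definition net_flow :: "curve \<Rightarrow> field \<Rightarrow> real" where
  "net_flow \<phi> h =
     integral {0..2 * pi} (\<lambda>\<theta>. h (lift \<phi> \<theta>) \<bullet> vector [velocity \<phi> \<theta> $ 2, - (velocity \<phi> \<theta> $ 1)])"

definition boundary_data :: "curve \<Rightarrow> field \<Rightarrow> bool" where
  "boundary_data \<phi> h \<longleftrightarrow> continuous_on (bd \<phi>) h \<and> net_flow \<phi> h = 0"

text \<open>If one of the norms vanishes the quotient is \<open>0\<close>, so that for \<open>\<eta> > 0\<close> aligned fields are
  nonzero in \<open>L\<^sup>2\<close>.\<close>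

definition aligned :: "curve \<Rightarrow> real \<Rightarrow> field \<Rightarrow> field \<Rightarrow> bool" where
  "aligned \<phi> \<eta> v w \<longleftrightarrow> bd_inner \<phi> v w / (bd_norm \<phi> v * bd_norm \<phi> w) \<ge> \<eta>"

definition as_uniformly_aligned ::
    "'o measure \<Rightarrow> ('o \<Rightarrow> curve) \<Rightarrow> real \<Rightarrow> ('o \<Rightarrow> field) \<Rightarrow> ('o \<Rightarrow> field) \<Rightarrow> bool" where
  "as_uniformly_aligned M \<phi> \<eta> v w \<longleftrightarrow> (AE \<omega> in M. aligned (\<phi> \<omega>) \<eta> (v \<omega>) (w \<omega>))"


definition dir_deriv :: "plane \<Rightarrow> (plane \<Rightarrow> 'b::real_normed_vector) \<Rightarrow> plane \<Rightarrow> 'b" where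
  "dir_deriv v f x = frechet_derivative f (at x) v"

definition C1_on :: "plane set \<Rightarrow> (plane \<Rightarrow> 'b::real_normed_vector) \<Rightarrow> bool" where
  "C1_on Y f \<longleftrightarrow> (\<forall>x\<in>Y. f differentiable (at x)) \<and> (\<forall>v. continuous_on Y (dir_deriv v f))"

definition C2_on :: "plane set \<Rightarrow> (plane \<Rightarrow> 'b::real_normed_vector) \<Rightarrow> bool" where
  "C2_on Y f \<longleftrightarrow> C1_on Y f \<and> (\<forall>v. C1_on Y (dir_deriv v f))"

definition laplacian :: "field \<Rightarrow> field" where
  "laplacian u x = (\<Sum>e\<in>Basis. dir_deriv e (dir_deriv e u) x)"

definition gradient :: "(plane \<Rightarrow> real) \<Rightarrow> field" where
  "gradient p x = (\<Sum>e\<in>Basis. dir_deriv e p x *\<^sub>R e)"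

definition divergence :: "field \<Rightarrow> plane \<Rightarrow> real" where
  "divergence u x = (\<Sum>e\<in>Basis. dir_deriv e u x \<bullet> e)"

text \<open>Classical solutions: the velocity attains the merely continuous data continuously.\<close>

definition stokes_solution :: "curve \<Rightarrow> field \<Rightarrow> field \<Rightarrow> (plane \<Rightarrow> real) \<Rightarrow> bool" where
  "stokes_solution \<phi> h u p \<longleftrightarrow>
     C2_on (micro_domain \<phi>) u \<and> C1_on (micro_domain \<phi>) p \<and>
     continuous_on (closure (micro_domain \<phi>)) u \<and>
     (\<forall>x\<in>micro_domain \<phi>. - laplacian u x + gradient p x = 0 \<and> divergence u x = 0) \<and>
     (\<forall>x\<in>bd \<phi>. u x = h x)"


text \<open>A segment carries the choice of its unit tangent (from start to end) and of one of its two
  unit normals.\<close>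

record oriented_segment =
  seg_start :: plane
  seg_end :: plane
  seg_normal :: plane

definition seg_length :: "oriented_segment \<Rightarrow> real" where
  "seg_length L = norm (seg_end L - seg_start L)"

definition seg_tangent :: "oriented_segment \<Rightarrow> plane" where
  "seg_tangent L = (seg_end L - seg_start L) /\<^sub>R seg_length L"

definition segment_in :: "oriented_segment \<Rightarrow> plane set \<Rightarrow> bool" where
  "segment_in L Y \<longleftrightarrow>
     seg_start L \<noteq> seg_end L \<and> norm (seg_normal L) = 1 \<and> seg_normal L \<bullet> seg_tangent L = 0 \<and>
     closed_segment (seg_start L) (seg_end L) \<subseteq> Y"

definition seg_inner :: "oriented_segment \<Rightarrow> field \<Rightarrow> field \<Rightarrow> real" where
  "seg_inner L u v =
     seg_length L * integral {0..1}
       (\<lambda>s. u (linepath (seg_start L) (seg_end L) s) \<bullet> v (linepath (seg_start L) (seg_end L) s))"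

text \<open>Representors are unique only up to multiples of the boundary normal; the predicates below
  admit every choice.\<close>

definition riesz_representor1 :: "curve \<Rightarrow> oriented_segment \<Rightarrow> field \<Rightarrow> bool" where
  "riesz_representor1 \<phi> L r \<longleftrightarrow>
     continuous_on (bd \<phi>) r \<and>
     (\<forall>h u p. boundary_data \<phi> h \<longrightarrow> stokes_solution \<phi> h u p \<longrightarrow>
        bd_inner \<phi> r h = seg_inner L u (\<lambda>_. seg_tangent L))"

definition riesz_representor2 :: "curve \<Rightarrow> oriented_segment \<Rightarrow> field \<Rightarrow> bool" where
  "riesz_representor2 \<phi> L r \<longleftrightarrow>
     continuous_on (bd \<phi>) r \<and>
     (\<forall>h u p. boundary_data \<phi> h \<longrightarrow> stokes_solution \<phi> h u p \<longrightarrow>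
        bd_inner \<phi> r h = seg_inner L (dir_deriv (seg_normal L) u) (\<lambda>_. seg_tangent L))"

end

theory Submission
  imports Defs
begin

text \<open>Write \<open>a, b\<close> for the pairings of \<open>r1, r2\<close> with \<open>h\<close> and \<open>a', b'\<close> for those of \<open>s1, s2\<close>.  The
  difference of the two slip amounts factors as \<open>a / b - a' / b' = (a / b) (1 - (a' / a) (b / b'))\<close>.
  The first factor is at most \<open>C\<close>.  In the second, both quotients are close to \<open>1\<close>:
  \<open>a' / a - 1\<close> is the pairing of \<open>s1 - r1\<close> with \<open>h\<close> divided by \<open>a\<close>, where Cauchy--Schwarz bounds
  the numerator from above and alignment bounds \<open>a\<close> from below by \<open>\<eta>1\<close> times the product of
  the norms.  The norm of \<open>h\<close> cancels, and what remains is at most \<open>x / \<eta>1\<close>, with \<open>x\<close> the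
  relative error of \<open>s1\<close> (\<open>relative_pairing_error\<close>).  In the same way \<open>b / b' - 1\<close> is at most
  \<open>y / \<eta>2\<close>; this is why the second error is measured relative to the norm of \<open>s2\<close> and why it is
  \<open>s2\<close>, and not \<open>r2\<close>, that has to be aligned with \<open>h\<close>.  Multiplying out bounds the difference by
  \<open>C (x / \<eta>1 + y / \<eta>2 + x y / (\<eta>1 \<eta>2))\<close> almost surely (\<open>quotient_perturbation\<close>).

  It remains to take expectations, given that \<open>x\<^sup>2\<close> and \<open>y\<^sup>2\<close> have mean at most \<open>\<delta>\<^sup>2\<close>.  The
  means of \<open>x\<close>, \<open>y\<close> and \<open>x y\<close> are then at most \<open>\<delta>\<close>, \<open>\<delta>\<close> and \<open>\<delta>\<^sup>2\<close>
  (\<open>expectation_first_order_bound\<close>).\<close>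

lemma square_le_prod_if_quadratic_nonneg:
  fixes a b c :: real
  assumes nonneg: "\<And>t. 0 \<le> a - 2 * b * t + c * t\<^sup>2"
  shows "b\<^sup>2 \<le> a * c"
proof (cases "c = 0")
  case True
  have "b = 0"
  proof (rule ccontr)
    assume "b \<noteq> 0"
    \<comment> \<open>With \<open>c = 0\<close> the polynomial is affine; this argument gives it the value \<open>-1\<close>.\<close>
    then show False
      using nonneg[of "(a + 1) / (2 * b)"] True by simp
  qed
  then show ?thesis using True by simp
next
  case False
  have "0 \<le> c"
  proof (rule ccontr)
    assume neg: "\<not> 0 \<le> c"
    \<comment> \<open>A concave parabola is negative at one of two points symmetric about \<open>0\<close> far enough out.\<close>
    define t where "t = 1 + \<bar>a / c\<bar>"
    have "1 \<le> t" by (simp add: t_def)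
    then have "t \<le> t\<^sup>2" by (simp add: power2_eq_square)
    have "0 \<le> a + c * t\<^sup>2"
      using nonneg[of t] nonneg[of "- t"] by simp
    moreover have "c * t\<^sup>2 \<le> c * t"
      using neg \<open>t \<le> t\<^sup>2\<close> by (simp add: mult_left_mono_neg)
    moreover have "c * t = c - \<bar>a\<bar>"
      using neg by (simp add: t_def field_simps abs_divide)
    ultimately show False using neg by linarith
  qed
  then have "0 < c" using False by simp
  then show ?thesis
    using nonneg[of "b / c"] by (simp add: field_simps power2_eq_square)
qed

lemma continuous_on_lift: "micro_curve \<phi> \<Longrightarrow> continuous_on S (lift \<phi>)"
  unfolding micro_curve_def C2_circle_def
  by (meson C1_differentiable_imp_continuous_on continuous_on_subset subset_UNIV)

lemma continuous_on_velocity: "micro_curve \<phi> \<Longrightarrow> continuous_on S (velocity \<phi>)"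
  unfolding micro_curve_def C2_circle_def
  by (meson C1_differentiable_imp_continuous_on continuous_on_subset subset_UNIV)

lemma lift_in_bd: "lift \<phi> \<theta> \<in> bd \<phi>"
  by (auto simp: lift_def bd_def)

lemma bd_inner_integrable:
  fixes f g :: field
  assumes "micro_curve \<phi>" "continuous_on (bd \<phi>) f" "continuous_on (bd \<phi>) g"
  shows "(\<lambda>\<theta>. (f (lift \<phi> \<theta>) \<bullet> g (lift \<phi> \<theta>)) * norm (velocity \<phi> \<theta>)) integrable_on {0..2 * pi}"
proof (rule integrable_continuous_real)
  have comp: "continuous_on {0..2 * pi} (\<lambda>\<theta>. k (lift \<phi> \<theta>))" if "continuous_on (bd \<phi>) k" for k :: field
    using continuous_on_compose2[OF that continuous_on_lift[OF assms(1)]] lift_in_bd by blast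
  show "continuous_on {0..2 * pi}
      (\<lambda>\<theta>. (f (lift \<phi> \<theta>) \<bullet> g (lift \<phi> \<theta>)) * norm (velocity \<phi> \<theta>))"
    by (intro continuous_on_mult continuous_on_inner continuous_on_norm continuous_on_velocity
        comp assms)
qed

lemma bd_inner_commute: "bd_inner \<phi> f g = bd_inner \<phi> g f"
  by (simp add: bd_inner_def inner_commute)

lemma bd_inner_nonneg: "0 \<le> bd_inner \<phi> f f"
  unfolding bd_inner_def
  \<comment> \<open>For a field whose square is not integrable the integral is \<open>0\<close> by convention.\<close>
  by (cases "(\<lambda>\<theta>. (f (lift \<phi> \<theta>) \<bullet> f (lift \<phi> \<theta>)) * norm (velocity \<phi> \<theta>)) integrable_on {0..2 * pi}")
    (auto intro: integral_nonneg simp: not_integrable_integral)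

lemma bd_inner_diff_left:
  assumes "micro_curve \<phi>" "continuous_on (bd \<phi>) f" "continuous_on (bd \<phi>) g"
    and "continuous_on (bd \<phi>) k"
  shows "bd_inner \<phi> (\<lambda>x. f x - g x) k = bd_inner \<phi> f k - bd_inner \<phi> g k"
  unfolding bd_inner_def
  by (subst integral_diff[symmetric])
    (auto intro!: bd_inner_integrable assms simp: inner_diff_left left_diff_distrib)

lemma bd_inner_scaleR_left: "bd_inner \<phi> (\<lambda>x. c *\<^sub>R f x) k = c * bd_inner \<phi> f k"
  unfolding bd_inner_def by (simp add: mult.assoc)

lemma bd_norm_nonneg: "0 \<le> bd_norm \<phi> f"
  by (simp add: bd_norm_def bd_inner_nonneg)

lemma bd_inner_Cauchy_Schwarz:
  assumes \<phi>: "micro_curve \<phi>" and f: "continuous_on (bd \<phi>) f" and g: "continuous_on (bd \<phi>) g"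
  shows "\<bar>bd_inner \<phi> f g\<bar> \<le> bd_norm \<phi> f * bd_norm \<phi> g"
proof -
  have "0 \<le> bd_inner \<phi> f f - 2 * bd_inner \<phi> f g * t + bd_inner \<phi> g g * t\<^sup>2" for t
  proof -
    have tg: "continuous_on (bd \<phi>) (\<lambda>x. t *\<^sub>R g x)"
      and ftg: "continuous_on (bd \<phi>) (\<lambda>x. f x - t *\<^sub>R g x)"
      using f g by (auto intro!: continuous_intros)
    have right: "bd_inner \<phi> k (\<lambda>x. f x - t *\<^sub>R g x) = bd_inner \<phi> f k - t * bd_inner \<phi> g k"
      if "continuous_on (bd \<phi>) k" for k
      using bd_inner_diff_left[OF \<phi> f tg that]
      by (simp add: bd_inner_commute[of _ k] bd_inner_scaleR_left)
    have "0 \<le> bd_inner \<phi> (\<lambda>x. f x - t *\<^sub>R g x) (\<lambda>x. f x - t *\<^sub>R g x)"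
      by (rule bd_inner_nonneg)
    also have "\<dots> = bd_inner \<phi> f (\<lambda>x. f x - t *\<^sub>R g x) - t * bd_inner \<phi> g (\<lambda>x. f x - t *\<^sub>R g x)"
      using bd_inner_diff_left[OF \<phi> f tg ftg] by (simp add: bd_inner_scaleR_left)
    also have "\<dots> = bd_inner \<phi> f f - 2 * bd_inner \<phi> f g * t + bd_inner \<phi> g g * t\<^sup>2"
      by (simp add: right[OF f] right[OF g] bd_inner_commute[of \<phi> g f] power2_eq_square
          algebra_simps)
    finally show ?thesis .
  qed
  from square_le_prod_if_quadratic_nonneg[OF this] show ?thesis
    unfolding bd_norm_def by (metis real_sqrt_abs real_sqrt_le_iff real_sqrt_mult)
qed

text \<open>Vanishing norms are excluded because the quotient defining alignment would then be \<open>0 < \<eta>\<close>.\<close>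

lemma aligned_lower_bound:
  assumes "aligned \<phi> \<eta> v w" "0 < \<eta>"
  shows "0 < bd_norm \<phi> v" "0 < bd_norm \<phi> w"
    and "\<eta> * (bd_norm \<phi> v * bd_norm \<phi> w) \<le> bd_inner \<phi> v w"
proof -
  have "bd_norm \<phi> v * bd_norm \<phi> w \<noteq> 0"
    using assms by (auto simp: aligned_def)
  then show "0 < bd_norm \<phi> v" "0 < bd_norm \<phi> w"
    using bd_norm_nonneg[of \<phi> v] bd_norm_nonneg[of \<phi> w] by auto
  then show "\<eta> * (bd_norm \<phi> v * bd_norm \<phi> w) \<le> bd_inner \<phi> v w"
    using assms by (simp add: aligned_def pos_le_divide_eq)
qed

text \<open>Alignment turns an error relative to the norm of \<open>v\<close> into an error relative to the pairing
  itself, at the price of a factor \<open>1 / \<eta>\<close>: it prevents the pairing from being much smaller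
  than what Cauchy--Schwarz allows, so that cancellation cannot amplify the error.\<close>

lemma relative_pairing_error:
  assumes \<phi>: "micro_curve \<phi>"
    and v: "continuous_on (bd \<phi>) v" and w: "continuous_on (bd \<phi>) w" and h: "continuous_on (bd \<phi>) h"
    and al: "aligned \<phi> \<eta> v h" and \<eta>: "0 < \<eta>"
  shows "\<bar>bd_inner \<phi> w h - bd_inner \<phi> v h\<bar>
    \<le> inverse \<eta> * (bd_norm \<phi> (\<lambda>x. w x - v x) / bd_norm \<phi> v) * bd_inner \<phi> v h"
proof -
  let ?d = "bd_norm \<phi> (\<lambda>x. w x - v x)"
  note lower = aligned_lower_bound[OF al \<eta>]
  have "\<bar>bd_inner \<phi> w h - bd_inner \<phi> v h\<bar> = \<bar>bd_inner \<phi> (\<lambda>x. w x - v x) h\<bar>"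
    by (simp add: bd_inner_diff_left[OF \<phi> w v h])
  also have "\<dots> \<le> ?d * bd_norm \<phi> h"
    using \<phi> v w h by (intro bd_inner_Cauchy_Schwarz continuous_on_diff) auto
  also have "\<dots> = inverse \<eta> * (?d / bd_norm \<phi> v) * (\<eta> * (bd_norm \<phi> v * bd_norm \<phi> h))"
    using lower \<eta> by simp
  also have "\<dots> \<le> inverse \<eta> * (?d / bd_norm \<phi> v) * bd_inner \<phi> v h"
    using lower \<eta> bd_norm_nonneg by (intro mult_left_mono) auto
  finally show ?thesis .
qed

text \<open>The relative errors are taken with respect to \<open>a\<close> and \<open>b'\<close>, the numerator of one quotient and
  the denominator of the other, since these are the divisors in
  \<open>a / b - a' / b' = (a / b) (1 - (a' / a) (b / b'))\<close>.\<close>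

lemma quotient_perturbation:
  fixes a a' b b' p q C :: real
  assumes a: "0 < a" and b': "0 < b'" and b: "b \<noteq> 0"
    and C: "\<bar>a / b\<bar> \<le> C"
    and p: "\<bar>a' - a\<bar> \<le> p * a" and q: "\<bar>b - b'\<bar> \<le> q * b'"
  shows "\<bar>a / b - a' / b'\<bar> \<le> C * (p + q + p * q)"
proof -
  define u v where "u = (a' - a) / a" and "v = (b - b') / b'"
  have u: "\<bar>u\<bar> \<le> p" and v: "\<bar>v\<bar> \<le> q"
    using p q a b' by (simp_all add: u_def v_def abs_divide pos_divide_le_eq)
  have "a / b - a' / b' = - (a / b) * (u + v + u * v)"
    using a b b' by (simp add: u_def v_def field_simps)
  then have "\<bar>a / b - a' / b'\<bar> = \<bar>a / b\<bar> * \<bar>u + v + u * v\<bar>"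
    by (simp add: abs_mult)
  also have "\<dots> \<le> C * (p + q + p * q)"
  proof (rule mult_mono[OF C])
    have "\<bar>u + v + u * v\<bar> \<le> \<bar>u\<bar> + \<bar>v\<bar> + \<bar>u\<bar> * \<bar>v\<bar>"
      by (simp add: abs_mult[symmetric])
    also have "\<dots> \<le> p + q + p * q"
      using u v by (intro add_mono mult_mono) auto
    finally show "\<bar>u + v + u * v\<bar> \<le> p + q + p * q" .
  qed (use order_trans[OF abs_ge_zero C] in auto)
  finally show ?thesis .
qed

text \<open>Instead of Cauchy--Schwarz for expectations, the inequalities \<open>X \<le> (X\<^sup>2 / \<delta> + \<delta>) / 2\<close> and
  \<open>X Y \<le> (X\<^sup>2 + Y\<^sup>2) / 2\<close> are applied pointwise.  They lose nothing, since the right-hand sides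
  have mean at most \<open>\<delta>\<close> and \<open>\<delta>\<^sup>2\<close>, and they provide an integrable majorant that involves only
  \<open>X\<^sup>2\<close> and \<open>Y\<^sup>2\<close>, which yields integrability of \<open>F\<close> as well.\<close>

lemma expectation_first_order_bound:
  fixes F X Y :: "'o \<Rightarrow> real"
  assumes M: "prob_space M"
    and F: "F \<in> borel_measurable M"
    and X: "integrable M (\<lambda>\<omega>. (X \<omega>)\<^sup>2)" "prob_space.expectation M (\<lambda>\<omega>. (X \<omega>)\<^sup>2) \<le> \<delta>\<^sup>2"
    and Y: "integrable M (\<lambda>\<omega>. (Y \<omega>)\<^sup>2)" "prob_space.expectation M (\<lambda>\<omega>. (Y \<omega>)\<^sup>2) \<le> \<delta>\<^sup>2"
    and \<delta>: "0 < \<delta>" and \<alpha>: "0 \<le> \<alpha>" and \<beta>: "0 \<le> \<beta>" and C: "0 \<le> C"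
    and bound: "AE \<omega> in M. \<bar>F \<omega>\<bar> \<le> C * (\<alpha> * X \<omega> + \<beta> * Y \<omega> + (\<alpha> * X \<omega>) * (\<beta> * Y \<omega>))"
  shows "integrable M (\<lambda>\<omega>. \<bar>F \<omega>\<bar>) \<and>
    prob_space.expectation M (\<lambda>\<omega>. \<bar>F \<omega>\<bar>) \<le> C * (\<delta> * (\<alpha> + \<beta>) + \<delta>\<^sup>2 * \<alpha> * \<beta>)"
proof -
  interpret prob_space M by fact
  define G where "G \<omega> = C * (\<alpha> * (((X \<omega>)\<^sup>2 / \<delta> + \<delta>) / 2) + \<beta> * (((Y \<omega>)\<^sup>2 / \<delta> + \<delta>) / 2)
    + \<alpha> * \<beta> * (((X \<omega>)\<^sup>2 + (Y \<omega>)\<^sup>2) / 2))" for \<omega>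
  have linear: "z \<le> (z\<^sup>2 / \<delta> + \<delta>) / 2" for z
    using \<delta> sum_squares_bound[of z \<delta>] by (simp add: field_simps power2_eq_square)
  have product: "z * w \<le> (z\<^sup>2 + w\<^sup>2) / 2" for z w :: real
    using sum_squares_bound[of z w] by simp
  have majorant: "C * (\<alpha> * X \<omega> + \<beta> * Y \<omega> + (\<alpha> * X \<omega>) * (\<beta> * Y \<omega>)) \<le> G \<omega>" for \<omega>
  proof -
    have "(\<alpha> * X \<omega>) * (\<beta> * Y \<omega>) = \<alpha> * \<beta> * (X \<omega> * Y \<omega>)" by simp
    also have "\<dots> \<le> \<alpha> * \<beta> * (((X \<omega>)\<^sup>2 + (Y \<omega>)\<^sup>2) / 2)"
      using \<alpha> \<beta> by (intro mult_left_mono product) auto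
    finally show ?thesis
      unfolding G_def using \<alpha> \<beta> C by (intro mult_left_mono add_mono linear) auto
  qed
  have FG: "AE \<omega> in M. \<bar>F \<omega>\<bar> \<le> G \<omega>"
    using bound majorant by (auto intro: order_trans)
  have G: "integrable M G"
    unfolding G_def using X(1) Y(1) by simp
  have int: "integrable M (\<lambda>\<omega>. \<bar>F \<omega>\<bar>)"
    by (rule Bochner_Integration.integrable_bound[OF G]) (use F FG in auto)
  have "expectation (\<lambda>\<omega>. \<bar>F \<omega>\<bar>) \<le> expectation G"
    by (rule integral_mono_AE[OF int G FG])
  also have "expectation G = C * (\<alpha> * ((expectation (\<lambda>\<omega>. (X \<omega>)\<^sup>2) / \<delta> + \<delta>) / 2)
    + \<beta> * ((expectation (\<lambda>\<omega>. (Y \<omega>)\<^sup>2) / \<delta> + \<delta>) / 2)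
    + \<alpha> * \<beta> * ((expectation (\<lambda>\<omega>. (X \<omega>)\<^sup>2) + expectation (\<lambda>\<omega>. (Y \<omega>)\<^sup>2)) / 2))"
    unfolding G_def using X(1) Y(1) by (simp add: prob_space)
  also have "\<dots> \<le> C * (\<alpha> * ((\<delta>\<^sup>2 / \<delta> + \<delta>) / 2) + \<beta> * ((\<delta>\<^sup>2 / \<delta> + \<delta>) / 2)
    + \<alpha> * \<beta> * ((\<delta>\<^sup>2 + \<delta>\<^sup>2) / 2))"
    using X(2) Y(2) \<alpha> \<beta> C \<delta>
    by (intro mult_left_mono add_mono divide_right_mono) auto
  also have "\<dots> = C * (\<delta> * (\<alpha> + \<beta>) + \<delta>\<^sup>2 * \<alpha> * \<beta>)"
    using \<delta> by (simp add: power2_eq_square algebra_simps)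
  finally show ?thesis using int by blast
qed

theorem corollary5p3:
  fixes M :: "'o measure"
    and \<Phi> :: "curve set" and N :: "curve measure" and \<phi> :: "'o \<Rightarrow> curve"
    and Y :: "'o \<Rightarrow> plane set" and L :: "'o \<Rightarrow> oriented_segment"
    and R1 R2 :: "plane set \<Rightarrow> oriented_segment \<Rightarrow> field"
    and rt1 rt2 :: "plane set \<Rightarrow> oriented_segment \<Rightarrow> 'i"
    and Op :: "'i \<Rightarrow> plane set \<Rightarrow> field"
    and r1 r2 s1 s2 h :: "'o \<Rightarrow> field"
    and \<eta>1 \<eta>2 C \<delta> :: real
  assumes "prob_space M"
    and \<Phi>: "\<And>f. f \<in> \<Phi> \<Longrightarrow> micro_curve f"
    and N: "space N = \<Phi>"
    and \<phi>: "\<phi> \<in> measurable M N"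
    and Y: "\<And>\<omega>. \<omega> \<in> space M \<Longrightarrow> Y \<omega> = micro_domain (\<phi> \<omega>)"
    and L: "\<And>\<omega>. \<omega> \<in> space M \<Longrightarrow> segment_in (L \<omega>) (Y \<omega>)"
    and r1: "\<And>\<omega>. \<omega> \<in> space M \<Longrightarrow> r1 \<omega> = R1 (Y \<omega>) (L \<omega>)"
    and r2: "\<And>\<omega>. \<omega> \<in> space M \<Longrightarrow> r2 \<omega> = R2 (Y \<omega>) (L \<omega>)"
    and riesz1: "\<And>\<omega>. \<omega> \<in> space M \<Longrightarrow> riesz_representor1 (\<phi> \<omega>) (L \<omega>) (r1 \<omega>)"
    and riesz2: "\<And>\<omega>. \<omega> \<in> space M \<Longrightarrow> riesz_representor2 (\<phi> \<omega>) (L \<omega>) (r2 \<omega>)"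
    and s1: "\<And>\<omega>. \<omega> \<in> space M \<Longrightarrow> s1 \<omega> = Op (rt1 (Y \<omega>) (L \<omega>)) (bd (\<phi> \<omega>))"
    and s2: "\<And>\<omega>. \<omega> \<in> space M \<Longrightarrow> s2 \<omega> = Op (rt2 (Y \<omega>) (L \<omega>)) (bd (\<phi> \<omega>))"
    and s1_cont: "\<And>\<omega>. \<omega> \<in> space M \<Longrightarrow> continuous_on (bd (\<phi> \<omega>)) (s1 \<omega>)"
    and s2_cont: "\<And>\<omega>. \<omega> \<in> space M \<Longrightarrow> continuous_on (bd (\<phi> \<omega>)) (s2 \<omega>)"
    and h: "\<And>\<omega>. \<omega> \<in> space M \<Longrightarrow> boundary_data (\<phi> \<omega>) (h \<omega>)"
    and meas:
      "(\<lambda>\<omega>. bd_inner (\<phi> \<omega>) (r1 \<omega>) (h \<omega>)) \<in> borel_measurable M"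
      "(\<lambda>\<omega>. bd_inner (\<phi> \<omega>) (r2 \<omega>) (h \<omega>)) \<in> borel_measurable M"
      "(\<lambda>\<omega>. bd_inner (\<phi> \<omega>) (s1 \<omega>) (h \<omega>)) \<in> borel_measurable M"
      "(\<lambda>\<omega>. bd_inner (\<phi> \<omega>) (s2 \<omega>) (h \<omega>)) \<in> borel_measurable M"
    and \<eta>1: "0 < \<eta>1" "\<eta>1 < 1"
    and \<eta>2: "0 < \<eta>2" "\<eta>2 < 1"
    and aligned1: "as_uniformly_aligned M \<phi> \<eta>1 r1 h"
    and aligned2: "as_uniformly_aligned M \<phi> \<eta>2 s2 h"
    and C: "C > 0"
    and slip: "AE \<omega> in M. bd_inner (\<phi> \<omega>) (r2 \<omega>) (h \<omega>) \<noteq> 0 \<and>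
      \<bar>bd_inner (\<phi> \<omega>) (r1 \<omega>) (h \<omega>) / bd_inner (\<phi> \<omega>) (r2 \<omega>) (h \<omega>)\<bar> \<le> C"
    and \<delta>: "\<delta> > 0"
    and err1: "integrable M (\<lambda>\<omega>. (bd_norm (\<phi> \<omega>) (\<lambda>x. s1 \<omega> x - r1 \<omega> x))\<^sup>2 / (bd_norm (\<phi> \<omega>) (r1 \<omega>))\<^sup>2)"
      "prob_space.expectation M
        (\<lambda>\<omega>. (bd_norm (\<phi> \<omega>) (\<lambda>x. s1 \<omega> x - r1 \<omega> x))\<^sup>2 / (bd_norm (\<phi> \<omega>) (r1 \<omega>))\<^sup>2) \<le> \<delta>\<^sup>2"
    and err2: "integrable M (\<lambda>\<omega>. (bd_norm (\<phi> \<omega>) (\<lambda>x. s2 \<omega> x - r2 \<omega> x))\<^sup>2 / (bd_norm (\<phi> \<omega>) (s2 \<omega>))\<^sup>2)"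
      "prob_space.expectation M
        (\<lambda>\<omega>. (bd_norm (\<phi> \<omega>) (\<lambda>x. s2 \<omega> x - r2 \<omega> x))\<^sup>2 / (bd_norm (\<phi> \<omega>) (s2 \<omega>))\<^sup>2) \<le> \<delta>\<^sup>2"
  shows "integrable M (\<lambda>\<omega>. \<bar>bd_inner (\<phi> \<omega>) (r1 \<omega>) (h \<omega>) / bd_inner (\<phi> \<omega>) (r2 \<omega>) (h \<omega>)
          - bd_inner (\<phi> \<omega>) (s1 \<omega>) (h \<omega>) / bd_inner (\<phi> \<omega>) (s2 \<omega>) (h \<omega>)\<bar>) \<and>
    prob_space.expectation M (\<lambda>\<omega>. \<bar>bd_inner (\<phi> \<omega>) (r1 \<omega>) (h \<omega>) / bd_inner (\<phi> \<omega>) (r2 \<omega>) (h \<omega>)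
          - bd_inner (\<phi> \<omega>) (s1 \<omega>) (h \<omega>) / bd_inner (\<phi> \<omega>) (s2 \<omega>) (h \<omega>)\<bar>)
      \<le> C * (\<delta> * (inverse \<eta>1 + inverse \<eta>2) + \<delta>\<^sup>2 * inverse \<eta>1 * inverse \<eta>2)"
proof -
  define X where "X \<omega> = bd_norm (\<phi> \<omega>) (\<lambda>x. s1 \<omega> x - r1 \<omega> x) / bd_norm (\<phi> \<omega>) (r1 \<omega>)" for \<omega>
  define Z where "Z \<omega> = bd_norm (\<phi> \<omega>) (\<lambda>x. s2 \<omega> x - r2 \<omega> x) / bd_norm (\<phi> \<omega>) (s2 \<omega>)" for \<omega>
  have bound: "AE \<omega> in M. \<bar>bd_inner (\<phi> \<omega>) (r1 \<omega>) (h \<omega>) / bd_inner (\<phi> \<omega>) (r2 \<omega>) (h \<omega>)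
      - bd_inner (\<phi> \<omega>) (s1 \<omega>) (h \<omega>) / bd_inner (\<phi> \<omega>) (s2 \<omega>) (h \<omega>)\<bar>
    \<le> C * (inverse \<eta>1 * X \<omega> + inverse \<eta>2 * Z \<omega> + (inverse \<eta>1 * X \<omega>) * (inverse \<eta>2 * Z \<omega>))"
    using aligned1[unfolded as_uniformly_aligned_def] aligned2[unfolded as_uniformly_aligned_def]
      slip AE_space
  proof eventually_elim
    case (elim \<omega>)
    let ?c = "\<phi> \<omega>"
    have c: "micro_curve ?c"
      using \<Phi> N measurable_space[OF \<phi>] elim(4) by auto
    have cont: "continuous_on (bd ?c) (r1 \<omega>)" "continuous_on (bd ?c) (r2 \<omega>)"
      "continuous_on (bd ?c) (h \<omega>)"
      using riesz1[OF elim(4)] riesz2[OF elim(4)] h[OF elim(4)]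
      by (auto simp: riesz_representor1_def riesz_representor2_def boundary_data_def)
    note cont' = s1_cont[OF elim(4)] s2_cont[OF elim(4)]
    have pos: "0 < bd_inner ?c (r1 \<omega>) (h \<omega>)" "0 < bd_inner ?c (s2 \<omega>) (h \<omega>)"
      using aligned_lower_bound[OF elim(1) \<eta>1(1)] aligned_lower_bound[OF elim(2) \<eta>2(1)] \<eta>1(1) \<eta>2(1)
      by (meson mult_pos_pos less_le_trans)+
    have err_r1: "\<bar>bd_inner ?c (s1 \<omega>) (h \<omega>) - bd_inner ?c (r1 \<omega>) (h \<omega>)\<bar>
        \<le> inverse \<eta>1 * X \<omega> * bd_inner ?c (r1 \<omega>) (h \<omega>)"
      unfolding X_def by (rule relative_pairing_error[OF c cont(1) cont'(1) cont(3) elim(1) \<eta>1(1)])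
    have "bd_norm ?c (\<lambda>x. r2 \<omega> x - s2 \<omega> x) = bd_norm ?c (\<lambda>x. s2 \<omega> x - r2 \<omega> x)"
      by (simp add: bd_norm_def bd_inner_def inner_diff_left inner_diff_right algebra_simps)
    then have err_s2: "\<bar>bd_inner ?c (r2 \<omega>) (h \<omega>) - bd_inner ?c (s2 \<omega>) (h \<omega>)\<bar>
        \<le> inverse \<eta>2 * Z \<omega> * bd_inner ?c (s2 \<omega>) (h \<omega>)"
      unfolding Z_def
      using relative_pairing_error[OF c cont'(2) cont(2) cont(3) elim(2) \<eta>2(1)] by simp
    show ?case
      using elim(3) by (intro quotient_perturbation[OF pos _ _ err_r1 err_s2]) auto
  qed
  show ?thesis
    by (rule expectation_first_order_bound[OF \<open>prob_space M\<close> _ _ _ _ _ \<delta> _ _ _ bound])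
      (use meas err1 err2 \<eta>1 \<eta>2 C in \<open>simp_all add: X_def Z_def power_divide\<close>)
qed

end
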